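(* For every integer $k \ge 3$, $$\pi_{\vec{S}_k}(\emptyset) = \max_{0 \le x \le 1} \frac{kx(1-x)^{k-1}}{1-x^k}.$$ Moreover, if the maximum on the right-hand side is attained at $x = x_k$, then the iterated construction with parameter $x_k$ is (asymptotically) extremal: letting $D_n(x_k)$ be the $n$-vertex digraph described in the context, the induced density of $\vec{S}_k$ in $D_n(x_k)$ converges to $\pi_{\vec{S}_k}(\emptyset)$ as $n \to \infty$.
   Context: Directed graphs (digraphs) are finite, without loops, and between any two distinct vertices there is at most one directed edge. The directed star $\vec{S}_k$ is the digraph on $k$ vertices with one vertex called the center and exactly $k-1$ edges, one oriented from the center to each of the other $k-1$ vertices (the leaves). For a digraph $H$ on $h$ vertices and a digraph $D$ on $n\ge h$ vertices, the number of induced copies of $H$ in $D$ is the number of $h$-element subsets of $V(D)$ which induce a subdigraph isomorphic to $H$, and the induced density of $H$ in $D$ is this number divided by $\binom{n}{h}$. The inducibility $\pi_H(\emptyset)$ is the limit, as $n\to\infty$, of the maximum induced density of $H$ over all $n$-vertex digraphs. The function $\frac{kx(1-x)^{k-1}}{1-x^k}$ is extended continuously to $x=1$ (with value $0$ there, since $k\ge 3$). For $x\in(0,1)$, the iterated construction $D_n(x)$ is the $n$-vertex digraph defined recursively: for $n\le 1$ it has no edges; for $n \ge 2$, partition the vertex set into $A$ and $B$ with $|A| = \lfloor xn\rfloor$ and $|B| = n-|A|$ (that is, $|A| \approx xn$, $|B|\approx(1-x)n$), add all edges oriented from $A$ to $B$, put no edges inside $B$, and put a copy of $D_{|A|}(x)$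 inside $A$. *)

theory Defs
  imports Complex_Main "Graph_Theory.Graph_Theory"
begin

locale oriented_digraph = pair_digraph +
  assumes no_antiparallel: "(u, v) \<in> parcs G \<Longrightarrow> (v, u) \<notin> parcs G"

definition induced_copies :: "'b pair_pre_digraph \<Rightarrow> 'a pair_pre_digraph \<Rightarrow> 'a set set" where
  "induced_copies H G =
    {S. S \<subseteq> pverts G \<and> card S = card (pverts H) \<and>
        digraph_iso (with_proj G \<restriction> S) (with_proj H)}"

definition induced_density :: "'b pair_pre_digraph \<Rightarrow> 'a pair_pre_digraph \<Rightarrow> real" where
  "induced_density H G =
    real (card (induced_copies H G)) / real (card (pverts G) choose card (pverts H))"

text \<open>Every finite digraph is isomorphic to one whose vertices are natural numbers, so it
  suffices to let the digraphs in the maximum range over vertex sets in \<^typ>\<open>nat\<close>.\<close>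

definition max_induced_density :: "'b pair_pre_digraph \<Rightarrow> nat \<Rightarrow> real" where
  "max_induced_density H n =
    Max (induced_density H ` {G :: nat pair_pre_digraph. oriented_digraph G \<and> card (pverts G) = n})"

definition inducibility :: "'b pair_pre_digraph \<Rightarrow> real" where
  "inducibility H = lim (max_induced_density H)"

definition directed_star :: "nat \<Rightarrow> nat pair_pre_digraph" where
  "directed_star k = \<lparr>pverts = {..<k}, parcs = {0} \<times> {1..<k}\<rparr>"

text \<open>The value at \<open>1\<close> is the continuous extension for \<open>k \<ge> 3\<close>.\<close>

definition star_bound :: "nat \<Rightarrow> real \<Rightarrow> real" where
  "star_bound k x = (if x = 1 then 0 else real k * x * (1 - x) ^ (k - 1) / (1 - x ^ k))"

text \<open>The digraph \<open>D\<^sub>n(x)\<close> on \<open>{..<n}\<close>, with \<open>A = {..<a}\<close> and \<open>B = {a..<n}\<close>. Only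
  \<open>0 < x < 1\<close> is meaningful; the guard makes the recursion total (\<open>x = 1\<close> would
  give \<open>a = n\<close>).\<close>

function iterated_digraph :: "real \<Rightarrow> nat \<Rightarrow> nat pair_pre_digraph" where
  "iterated_digraph x n =
    (if n \<le> 1 \<or> x \<notin> {0<..<1} then \<lparr>pverts = {..<n}, parcs = {}\<rparr>
     else let a = nat \<lfloor>x * real n\<rfloor> in
       \<lparr>pverts = {..<n}, parcs = {..<a} \<times> {a..<n} \<union> parcs (iterated_digraph x a)\<rparr>)"
  by pat_completeness auto
termination
proof (relation "measure snd")
  fix x :: real and n a :: nat
  assume *: "\<not> (n \<le> 1 \<or> x \<notin> {0<..<1})" and a: "a = nat \<lfloor>x * real n\<rfloor>"
  then have "x * real n < 1 * real n"
    by (intro mult_strict_right_mono) auto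
  then have "\<lfloor>x * real n\<rfloor> < int n"
    by (simp add: floor_less_iff)
  then show "((x, a), (x, n)) \<in> measure snd"
    using * a by auto
qed simp

declare iterated_digraph.simps [simp del]


lemma oriented_directed_star: "oriented_digraph (directed_star k)"
  by unfold_locales (auto simp: directed_star_def)

lemma pverts_iterated_digraph [simp]: "pverts (iterated_digraph x n) = {..<n}"
  by (subst iterated_digraph.simps) (auto simp: Let_def)

lemma parcs_iterated_digraph:
  "parcs (iterated_digraph x n) \<subseteq> {(u, v). u < v \<and> v < n}"
proof (induction x n rule: iterated_digraph.induct)
  case (1 x n)
  show ?case
  proof (cases "n \<le> 1 \<or> x \<notin> {0<..<1}")
    case True
    then show ?thesis by (subst iterated_digraph.simps) auto
  next
    case False
    define a where "a = nat \<lfloor>x * real n\<rfloor>"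
    have IH: "parcs (iterated_digraph x a) \<subseteq> {(u, v). u < v \<and> v < a}"
      using "1.IH"[OF False] a_def by auto
    have "x * real n < 1 * real n"
      using False by (intro mult_strict_right_mono) auto
    then have "a \<le> n"
      unfolding a_def by linarith
    moreover have "parcs (iterated_digraph x n) =
        {..<a} \<times> {a..<n} \<union> parcs (iterated_digraph x a)"
      using False by (subst iterated_digraph.simps) (auto simp: Let_def a_def)
    ultimately show ?thesis using IH by fastforce
  qed
qed

lemma oriented_iterated_digraph: "oriented_digraph (iterated_digraph x n)"
proof -
  have *: "u < v \<and> v < n" if "(u, v) \<in> parcs (iterated_digraph x n)" for u v
    using parcs_iterated_digraph[of x n] that by blast
  have "parcs (iterated_digraph x n) \<subseteq> {..<n} \<times> {..<n}"
    using * by fastforce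
  then have "finite (parcs (iterated_digraph x n))"
    by (rule finite_subset) simp
  moreover have "(v, u) \<notin> parcs (iterated_digraph x n)"
    if "(u, v) \<in> parcs (iterated_digraph x n)" for u v
    using *[OF that] *[of v u] by linarith
  ultimately show ?thesis
    by unfold_locales (auto dest: *)
qed


text \<open>The maximum is over a finite nonempty set, and its limit exists: averaging over the
  digraphs with one vertex deleted shows that it is eventually decreasing.\<close>

lemma finite_induced_copies:
  assumes "finite (pverts G)"
  shows "finite (induced_copies H G)"
    "card (induced_copies H G) \<le> card (pverts G) choose card (pverts H)"
proof -
  have sub: "induced_copies H G \<subseteq> {S. S \<subseteq> pverts G \<and> card S = card (pverts H)}"
    by (auto simp: induced_copies_def)
  have fin: "finite {S. S \<subseteq> pverts G \<and> card S = card (pverts H)}"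
    using assms by (auto intro: finite_subset[of _ "Pow (pverts G)"])
  show "finite (induced_copies H G)"
    by (rule finite_subset[OF sub fin])
  show "card (induced_copies H G) \<le> card (pverts G) choose card (pverts H)"
    using card_mono[OF fin sub] n_subsets[OF assms] by simp
qed

lemma max_induced_density_wf:
  defines "D \<equiv> \<lambda>H n. induced_density H `
    {G :: nat pair_pre_digraph. oriented_digraph G \<and> card (pverts G) = n}"
  shows "finite (D H n)" "D H n \<noteq> {}"
proof -
  have "D H n \<subseteq> (\<lambda>i. real i / real (n choose card (pverts H))) ` {..n choose card (pverts H)}"
  proof
    fix d assume "d \<in> D H n"
    then obtain G :: "nat pair_pre_digraph" where G: "oriented_digraph G" "card (pverts G) = n"
      "d = induced_density H G"
      by (auto simp: D_def)
    interpret oriented_digraph G by (rule G)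
    show "d \<in> (\<lambda>i. real i / real (n choose card (pverts H))) ` {..n choose card (pverts H)}"
      using finite_induced_copies(2)[OF pair_finite_verts, of H] G(2,3)
      by (auto simp: induced_density_def)
  qed
  then show "finite (D H n)"
    by (rule finite_subset) auto
  have "oriented_digraph \<lparr>pverts = {..<n}, parcs = {}\<rparr>"
    by unfold_locales auto
  then show "D H n \<noteq> {}"
    unfolding D_def by force
qed

lemma induced_density_le_max:
  fixes G :: "nat pair_pre_digraph"
  assumes "oriented_digraph G"
  shows "induced_density H G \<le> max_induced_density H (card (pverts G))"
  unfolding max_induced_density_def
  using assms max_induced_density_wf(1)[of H "card (pverts G)"] by (intro Max_ge) auto

lemma max_induced_density_attained:
  obtains G :: "nat pair_pre_digraph" where "oriented_digraph G" "card (pverts G) = n"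
    "max_induced_density H n = induced_density H G"
  using Max_in[OF max_induced_density_wf, of H n] unfolding max_induced_density_def by auto

lemma max_induced_density_Suc_le:
  assumes "card (pverts H) \<le> n"
  shows "max_induced_density H (Suc n) \<le> max_induced_density H n"
proof -
  define h where "h = card (pverts H)"
  obtain G :: "nat pair_pre_digraph" where G: "oriented_digraph G" "card (pverts G) = Suc n"
    "max_induced_density H (Suc n) = induced_density H G"
    by (rule max_induced_density_attained)
  interpret oriented_digraph G by (rule G)
  define V where "V = pverts G"
  define M where "M = max_induced_density H n * real (n choose h)"
  have [simp]: "finite V" using pair_finite_verts by (simp add: V_def)
  have cV: "card V = Suc n" using G(2) by (simp add: V_def)
  define F where "F = (\<lambda>v. \<lparr>pverts = V - {v}, parcs = parcs G \<inter> (V - {v}) \<times> (V - {v})\<rparr>)"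
  have F: "oriented_digraph (F v)" for v
    by unfold_locales (auto simp: F_def pair_no_loops dest: no_antiparallel)
  have copies_F: "induced_copies H (F v) = {S \<in> induced_copies H G. v \<notin> S}" if "v \<in> V" for v
  proof -
    have pF: "pverts (F v) = V - {v}"
      by (simp add: F_def)
    have "(S \<in> induced_copies H (F v)) = (S \<in> induced_copies H G \<and> v \<notin> S)" for S
    proof (cases "S \<subseteq> V - {v}")
      case True
      then have "with_proj (F v) \<restriction> S = with_proj G \<restriction> S"
        by (auto simp: F_def induce_subgraph_def)
      moreover have "S \<subseteq> pverts (F v)" "S \<subseteq> pverts G" "v \<notin> S"
        using True unfolding V_def[symmetric] pF by blast+
      ultimately show ?thesis
        by (simp add: induced_copies_def)
    next
      case False
      then have "\<not> S \<subseteq> pverts (F v)" "\<not> (S \<subseteq> pverts G \<and> v \<notin> S)"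
        unfolding V_def[symmetric] pF by blast+
      then show ?thesis
        unfolding induced_copies_def by blast
    qed
    then show ?thesis
      by (intro set_eqI) simp
  qed
  have pos: "real (n choose h) > 0"
    using assms by (simp add: h_def zero_less_binomial)
  have le_M: "real (card {S \<in> induced_copies H G. v \<notin> S}) \<le> M" if "v \<in> V" for v
  proof -
    have "card (pverts (F v)) = n" using that cV by (simp add: F_def)
    then have "induced_density H (F v) \<le> max_induced_density H n"
      using induced_density_le_max[OF F, of H v] by simp
    then show ?thesis
      using pos \<open>card (pverts (F v)) = n\<close> copies_F[OF that]
      by (simp add: induced_density_def M_def h_def field_simps)
  qed
  have fin: "finite (induced_copies H G)"
    using finite_induced_copies(1)[OF pair_finite_verts] .
  have "(\<Sum>v\<in>V. card {S \<in> induced_copies H G. v \<notin> S})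
      = (\<Sum>S\<in>induced_copies H G. card {v \<in> V. v \<notin> S})"
  proof -
    have "(\<Sum>v\<in>V. card {S \<in> induced_copies H G. v \<notin> S})
      = (\<Sum>v\<in>V. \<Sum>S\<in>induced_copies H G. if v \<notin> S then 1 else 0)"
      using fin by (simp add: sum.If_cases Int_def)
    also have "\<dots> = (\<Sum>S\<in>induced_copies H G. \<Sum>v\<in>V. if v \<notin> S then 1 else 0)"
      by (rule sum.swap)
    also have "\<dots> = (\<Sum>S\<in>induced_copies H G. card {v \<in> V. v \<notin> S})"
      by (simp add: sum.If_cases Int_def)
    finally show ?thesis .
  qed
  also have "\<dots> = (\<Sum>S\<in>induced_copies H G. Suc n - h)"
  proof (rule sum.cong)
    fix S assume "S \<in> induced_copies H G"
    then have S: "S \<subseteq> V" "card S = h" by (auto simp: induced_copies_def V_def h_def)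
    have "{v \<in> V. v \<notin> S} = V - S" by auto
    then show "card {v \<in> V. v \<notin> S} = Suc n - h"
      using S cV by (simp add: card_Diff_subset finite_subset)
  qed simp
  finally have "card (induced_copies H G) * (Suc n - h)
      = (\<Sum>v\<in>V. card {S \<in> induced_copies H G. v \<notin> S})" by simp
  then have "real (card (induced_copies H G)) * real (Suc n - h)
      = (\<Sum>v\<in>V. real (card {S \<in> induced_copies H G. v \<notin> S}))"
    unfolding of_nat_mult[symmetric] of_nat_sum[symmetric] by (rule arg_cong)
  also have "\<dots> \<le> real (card V) * M"
    using le_M by (rule sum_bounded_above)
  finally have *: "real (card (induced_copies H G)) * real (Suc n - h) \<le> real (Suc n) * M"
    by (simp add: cV)
  have "(Suc n choose h) * (Suc n - h) = Suc n * (n choose h)"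
    using assms binomial_absorb_comp[of "Suc n" h] by (simp add: h_def mult.commute)
  then have **: "real (Suc n choose h) * real (Suc n - h) = real (Suc n) * real (n choose h)"
    unfolding of_nat_mult[symmetric] by (rule arg_cong)
  have pos2: "real (Suc n - h) > 0" "real (Suc n choose h) > 0"
    using assms by (auto simp: h_def zero_less_binomial)
  have "real (card (induced_copies H G)) * real (Suc n - h)
      \<le> max_induced_density H n * real (Suc n choose h) * real (Suc n - h)"
    using * ** by (simp add: M_def mult_ac)
  then have "real (card (induced_copies H G)) \<le> max_induced_density H n * real (Suc n choose h)"
    using pos2(1) by (simp only: mult_le_cancel_right_pos)
  then show ?thesis
    using pos2(2) G(2) unfolding G(3) induced_density_def h_def[symmetric]
    by (simp add: divide_le_eq)
qed

lemma inducibility_LIMSEQ: "max_induced_density H \<longlonglongrightarrow> inducibility H"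
proof -
  define h where "h = card (pverts H)"
  have "decseq (\<lambda>n. max_induced_density H (n + h))"
    by (rule decseq_SucI) (use max_induced_density_Suc_le[of H] in \<open>simp add: h_def\<close>)
  moreover have "0 \<le> max_induced_density H (n + h)" for n
    using max_induced_density_attained[of "n + h" H]
    by (metis divide_nonneg_nonneg induced_density_def of_nat_0_le_iff)
  ultimately obtain L where "(\<lambda>n. max_induced_density H (n + h)) \<longlonglongrightarrow> L"
    using decseq_convergent by blast
  then have "max_induced_density H \<longlonglongrightarrow> L"
    by (rule LIMSEQ_offset)
  then show ?thesis
    by (simp add: inducibility_def limI)
qed

end

theory Submission
  imports Defs "HOL-Combinatorics.Permutations"
begin

text \<open>
  An oriented graph on \<open>n\<close> vertices carries a homogeneous polynomial of degree \<open>k\<close>, its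
  \<^emph>\<open>star weight\<close>: give the vertices weights \<open>w\<close> and sum \<open>w (f 0) \<cdots> w (f (k - 1))\<close> over all ways
  \<open>f\<close> to place a centre and \<open>k - 1\<close> ordered, pairwise non-adjacent and possibly repeated leaves.
  If \<open>w\<close> sums to \<open>1\<close>, this is the limit of the number of stars with ordered leaves, divided by \<open>N^k\<close>,
  in the blow-up to \<open>N\<close> vertices whose classes have sizes proportional to \<open>w\<close>. At \<open>w = 1\<close> it is at least \<open>(k - 1)!\<close> times the number of induced stars.

  The upper bound is a bound of the form \<open>c * (\<Sum>w)^k\<close> on the star weight, where \<open>c\<close> is any number
  with \<open>x * (1 - x)^(k - 1) \<le> c * (1 - x^k)\<close> on \<open>[0, 1]\<close>. It is proved in two steps.

  \<^item> \<^emph>\<open>Zykov symmetrisation\<close> (\<open>star_weight_merge\<close>). Let \<open>u\<close>, \<open>v\<close> be non-adjacent. Turning \<open>v\<close> into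
    a clone of \<open>u\<close>, or \<open>u\<close> into a clone of \<open>v\<close>, keeps every star that uses both, as they are both
    leaves in it. A star through only one of them survives the change that copies this vertex, and
    gains at least the factor \<open>(w u + w v) / w u\<close> or \<open>(w u + w v) / w v\<close>. So the original weight is at
    most the mean of the two new ones, taken in the ratio of \<open>w u\<close> to \<open>w v\<close>. Clones can be merged into one
    vertex, so by induction only tournaments remain.

  \<^item> \<^emph>\<open>Tournaments\<close> (\<open>tournament_weight_le\<close>). All leaves now coincide, and the weight is the sum
    of \<open>w a * w b ^ (k - 1)\<close> over the arcs \<open>(a, b)\<close>. An arc contributes most when it points to
    its heavier end, so a vertex \<open>t\<close> of maximal weight contributes at most \<open>y * w t ^ (k - 1)\<close>, where
    \<open>y\<close> is the weight of all other vertices. By induction these contribute at most \<open>c * y^k\<close>, and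
    \<open>c * y^k + y * z^(k - 1) \<le> c * (y + z)^k\<close> is the defining property of \<open>c\<close> at \<open>x = y / (y + z)\<close>.

  For the lower bound, the number \<open>N n\<close> of stars in the iterated construction satisfies
  \<open>N n \<ge> a * (n - a choose (k - 1)) + N a\<close> with \<open>a = \<lfloor>x * n\<rfloor>\<close>, and the recursion
  \<open>\<gamma> = x * (1 - x)^(k - 1) / (k - 1)! + \<gamma> * x^k\<close> for the leading coefficient has the solution
  \<open>star_bound k x / k!\<close>. Both bounds meet when \<open>x\<close> maximises \<open>star_bound k\<close>, which also squeezes the
  density of the iterated construction.
\<close>

section \<open>The star weight of a weighted digraph\<close>

text \<open>
  The entry \<open>f 0\<close> is the centre. Leaves may coincide: in a blow-up, several leaves of a star can lie
  in the same class.\<close>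

definition star_map :: "('a \<times> 'a) set \<Rightarrow> nat \<Rightarrow> (nat \<Rightarrow> 'a) \<Rightarrow> bool" where
  "star_map E k f \<longleftrightarrow>
    (\<forall>i\<in>{1..<k}. (f 0, f i) \<in> E) \<and> (\<forall>i\<in>{1..<k}. \<forall>j\<in>{1..<k}. (f i, f j) \<notin> E)"

definition star_weight :: "('a \<times> 'a) set \<Rightarrow> nat \<Rightarrow> 'a set \<Rightarrow> ('a \<Rightarrow> real) \<Rightarrow> real" where
  "star_weight E k V w = (\<Sum>f\<in>{..<k} \<rightarrow>\<^sub>E V. of_bool (star_map E k f) * (\<Prod>i<k. w (f i)))"

lemma star_map_cong: "(\<And>i. i < k \<Longrightarrow> f i = g i) \<Longrightarrow> k > 0 \<Longrightarrow> star_map E k f \<longleftrightarrow> star_map E k g"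
  unfolding star_map_def by auto

text \<open>
  A star that uses two non-adjacent vertices has both as leaves. Each of them is then an out-neighbour
  of the centre and adjacent to no leaf, so any occurrences of one may be replaced by the other.\<close>

lemma star_map_mixed:
  assumes "star_map E k f" "k > 0" "(u, v) \<notin> E" "(v, u) \<notin> E"
    and f: "\<And>i. i < k \<Longrightarrow> f i \<noteq> g i \<Longrightarrow> {f i, g i} = {u, v}"
    and "i < k" "f i = u" "j < k" "f j = v"
  shows "star_map E k g"
proof -
  have centre: "(f 0, f l) \<in> E" if "l \<in> {1..<k}" for l
    using assms(1) that by (auto simp: star_map_def)
  have leaves: "(f l, f m) \<notin> E" if "l \<in> {1..<k}" "m \<in> {1..<k}" for l m
    using assms(1) that by (auto simp: star_map_def)
  show ?thesis
  proof (cases "u = v")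
    case True
    then have "\<And>i. i < k \<Longrightarrow> f i = g i"
      using f by (metis doubleton_eq_iff)
    then show ?thesis using assms(1,2) star_map_cong by metis
  next
    case False
    have "i \<noteq> j" using False assms by auto
    have "i \<noteq> 0"
    proof
      assume "i = 0"
      then have "j \<in> {1..<k}" using \<open>i \<noteq> j\<close> assms by auto
      from centre[OF this] show False using \<open>i = 0\<close> assms by simp
    qed
    moreover have "j \<noteq> 0"
    proof
      assume "j = 0"
      then have "i \<in> {1..<k}" using \<open>i \<noteq> j\<close> assms by auto
      from centre[OF this] show False using \<open>j = 0\<close> assms by simp
    qed
    ultimately have ij: "i \<in> {1..<k}" "j \<in> {1..<k}" using assms by auto
    have "f 0 \<noteq> u" "f 0 \<noteq> v" using centre[OF ij(1)] centre[OF ij(2)] assms by auto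
    then have 0: "g 0 = f 0" using f[of 0] \<open>k > 0\<close> by (metis doubleton_eq_iff)
    have step: "\<exists>l'\<in>{1..<k}. g l = f l'" if "l \<in> {1..<k}" for l
    proof (cases "f l = g l")
      case True
      then show ?thesis using that by (metis True)
    next
      case False
      then have "g l = f i \<or> g l = f j"
        using f[of l] that assms(7,9) by (auto simp: doubleton_eq_iff)
      then show ?thesis using ij by blast
    qed
    show ?thesis
      unfolding star_map_def using 0 centre leaves by (metis step)
  qed
qed

section \<open>Zykov symmetrisation\<close>

text \<open>
  The two digraphs compared on the right both live on \<open>V - {v}\<close>, where \<open>u\<close> carries the combined
  weight: in \<open>E\<close> it keeps its own neighbourhood, in \<open>E'\<close> it has received that of \<open>v\<close>. Group the maps
  into \<open>V\<close> by their image \<open>g\<close> under \<open>v \<mapsto> u\<close>. The weights of the maps above \<open>g\<close> add up to the weight of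
  \<open>g\<close> after merging. If \<open>g\<close> is a star for both \<open>E\<close> and \<open>E'\<close>, this total suffices. If \<open>g\<close> is one only
  for \<open>E\<close>, no mixed map above it is a star by the previous lemma, which leaves \<open>g\<close> itself; since it
  uses \<open>u\<close> at least once, its weight is at most the fraction \<open>l = w u / (w u + w v)\<close> of the total.
  The case of \<open>E'\<close> is symmetric, with the fraction \<open>1 - l\<close>.\<close>

lemma star_weight_merge:
  fixes w :: "'a \<Rightarrow> real"
  assumes "finite V" "u \<in> V" "v \<in> V" "u \<noteq> v" "(u, v) \<notin> E" "(v, u) \<notin> E"
    and w: "\<And>x. 0 \<le> w x" and "k > 0"
  defines "E' \<equiv> {(a, b). ((if a = u then v else a), (if b = u then v else b)) \<in> E}"
    and "W \<equiv> w(u := w u + w v)"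
  obtains l where "0 \<le> l" "l \<le> 1"
    "star_weight E k V w \<le> l * star_weight E k (V - {v}) W + (1 - l) * star_weight E' k (V - {v}) W"
proof
  \<comment> \<open>If both weights vanish, division by zero gives \<open>l = 0\<close>, which still satisfies the equations below.\<close>
  define l where "l = w u / (w u + w v)"
  show "0 \<le> l" "l \<le> 1" using w[of u] w[of v] by (auto simp: l_def divide_le_eq_1)
  have l: "w u = l * W u"
    using w[of u] w[of v] by (cases "w u + w v = 0") (auto simp: l_def W_def)
  have l': "w v = (1 - l) * W u"
    using l by (simp add: W_def algebra_simps)
  have wW: "w x \<le> W x" for x using w by (simp add: W_def)
  define r where "r = (\<lambda>x. if x = v then u else x)"
  define I where "I = {..<k}"
  define F where "F = (\<lambda>g. PiE I (\<lambda>i. {x \<in> V. r x = g i}))"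
  have finF: "finite (F g)" for g unfolding F_def I_def using \<open>finite V\<close> by (intro finite_PiE) auto
  have fiber: "(\<Sum>f\<in>F g. of_bool (star_map E k f) * (\<Prod>i<k. w (f i)))
      \<le> (l * of_bool (star_map E k g) + (1 - l) * of_bool (star_map E' k g)) * (\<Prod>i<k. W (g i))"
    (is "?L \<le> ?R") if g: "g \<in> I \<rightarrow>\<^sub>E V - {v}" for g
  proof -
    have total: "(\<Sum>f\<in>F g. \<Prod>i<k. w (f i)) = (\<Prod>i<k. W (g i))"
    proof -
      have "sum w {x \<in> V. r x = g i} = W (g i)" if "i < k" for i
      proof -
        have "{x \<in> V. r x = g i} = (if g i = u then {u, v} else {g i})"
          using g that assms by (auto simp: r_def I_def PiE_iff)
        then show ?thesis using \<open>u \<noteq> v\<close> by (simp add: W_def)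
      qed
      then have "(\<Prod>i<k. W (g i)) = (\<Prod>i<k. sum w {x \<in> V. r x = g i})" by simp
      also have "\<dots> = (\<Sum>f\<in>F g. \<Prod>i<k. w (f i))"
        unfolding F_def I_def by (rule prod_sum_PiE) (use \<open>finite V\<close> in auto)
      finally show ?thesis by simp
    qed
    \<comment> \<open>\<open>g\<close> and \<open>g'\<close> are the two maps above \<open>g\<close> that avoid \<open>v\<close> and \<open>u\<close>, respectively.\<close>
    define g' where "g' = restrict (\<lambda>i. if g i = u then v else g i) I"
    have E'g: "star_map E' k g \<longleftrightarrow> star_map E k g'"
      using \<open>k > 0\<close> unfolding star_map_def E'_def g'_def I_def by auto
    have gF: "g \<in> F g" "g' \<in> F g"
      using g assms by (auto simp: F_def g'_def r_def PiE_iff I_def extensional_def)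
    have valid: "f = g \<or> f = g' \<or> star_map E k g \<and> star_map E k g'"
      if f: "f \<in> F g" and "star_map E k f" for f
    proof (cases "(\<exists>i<k. f i = u) \<and> (\<exists>i<k. f i = v)")
      case True
      have rf: "r (f i) = g i" if "i < k" for i using f that by (auto simp: F_def I_def PiE_iff)
      from True obtain i j where ij: "i < k" "f i = u" "j < k" "f j = v" by blast
      have "{f i, g i} = {u, v}" if "i < k" "f i \<noteq> g i" for i
        using rf[of i] that by (auto simp: r_def split: if_splits)
      then have "star_map E k g"
        by (rule star_map_mixed[OF \<open>star_map E k f\<close> \<open>k > 0\<close> assms(5,6) _ ij])
      moreover have "{f i, g' i} = {u, v}" if "i < k" "f i \<noteq> g' i" for i
        using rf[of i] that by (auto simp: r_def g'_def I_def split: if_splits)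
      then have "star_map E k g'"
        by (rule star_map_mixed[OF \<open>star_map E k f\<close> \<open>k > 0\<close> assms(5,6) _ ij])
      ultimately show ?thesis by blast
    next
      case False
      have rf: "r (f i) = g i" if "i \<in> I" for i using f that by (auto simp: F_def PiE_iff)
      have ext: "f \<in> extensional I" "g \<in> extensional I" "g' \<in> extensional I"
        using f g by (auto simp: F_def g'_def PiE_iff)
      have "f = g" if "\<not> (\<exists>i<k. f i = v)"
      proof (rule extensionalityI[OF ext(1,2)])
        fix i assume "i \<in> I"
        then show "f i = g i" using rf[of i] that by (auto simp: r_def I_def)
      qed
      moreover have "f = g'" if "\<not> (\<exists>i<k. f i = u)"
      proof (rule extensionalityI[OF ext(1,3)])
        fix i assume "i \<in> I"
        then show "f i = g' i"
          using rf[of i] that by (auto simp: r_def I_def g'_def split: if_splits)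
      qed
      ultimately show ?thesis using False by blast
    qed
    have use_u: "\<exists>i<k. g i = u" if "star_map E k g \<noteq> star_map E k g'"
    proof (rule ccontr)
      assume "\<not> (\<exists>i<k. g i = u)"
      then have "g i = g' i" if "i < k" for i using that by (simp add: g'_def I_def)
      then show False using star_map_cong[of k g g' E] \<open>k > 0\<close> that by blast
    qed
    consider "star_map E k g" "star_map E k g'" | "\<not> star_map E k g" "\<not> star_map E k g'"
      | "star_map E k g" "\<not> star_map E k g'" | "\<not> star_map E k g" "star_map E k g'" by blast
    then show ?thesis
    proof cases
      case 1
      have "?L \<le> (\<Sum>f\<in>F g. \<Prod>i<k. w (f i))"
        by (rule sum_mono) (use w in \<open>auto simp: prod_nonneg\<close>)
      then show ?thesis using 1 total by (simp add: E'g)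
    next
      case 2
      then have "?L = 0" using valid by (intro sum.neutral) auto
      then show ?thesis using 2 by (simp add: E'g)
    next
      case 3
      have "?L = (\<Sum>f\<in>{g}. of_bool (star_map E k f) * (\<Prod>i<k. w (f i)))"
        by (rule sum.mono_neutral_right) (use finF gF valid 3 in auto)
      also have "\<dots> = (\<Prod>i<k. w (g i))" using 3 by simp
      also have "\<dots> \<le> l * (\<Prod>i<k. W (g i))"
      proof -
        obtain i where i: "i < k" "g i = u"
          using use_u 3 by blast
        have "(\<Prod>i\<in>{..<k} - {i}. w (g i)) \<le> (\<Prod>i\<in>{..<k} - {i}. W (g i))"
          by (rule prod_mono) (use w wW in auto)
        then have "w u * (\<Prod>i\<in>{..<k} - {i}. w (g i)) \<le> w u * (\<Prod>i\<in>{..<k} - {i}. W (g i))"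
          using w by (rule mult_left_mono)
        then show ?thesis using i l l' by (simp add: prod.remove[of "{..<k}" i])
      qed
      finally show ?thesis using 3 by (simp add: E'g)
    next
      case 4
      have "?L = (\<Sum>f\<in>{g'}. of_bool (star_map E k f) * (\<Prod>i<k. w (f i)))"
        by (rule sum.mono_neutral_right) (use finF gF valid 4 in auto)
      also have "\<dots> = (\<Prod>i<k. w (g' i))" using 4 by simp
      also have "\<dots> \<le> (1 - l) * (\<Prod>i<k. W (g i))"
      proof -
        obtain i where i: "i < k" "g i = u"
          using use_u 4 by blast
        have "(\<Prod>i\<in>{..<k} - {i}. w (g' i)) \<le> (\<Prod>i\<in>{..<k} - {i}. W (g i))"
          by (rule prod_mono) (use w in \<open>auto simp: W_def g'_def I_def\<close>)
        then have "w v * (\<Prod>i\<in>{..<k} - {i}. w (g' i)) \<le> w v * (\<Prod>i\<in>{..<k} - {i}. W (g i))"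
          using w by (rule mult_left_mono)
        moreover have "g' i = v" using i by (simp add: g'_def I_def)
        ultimately show ?thesis using i l l' by (simp add: prod.remove[of "{..<k}" i])
      qed
      finally show ?thesis using 4 by (simp add: E'g)
    qed
  qed
  define P where "P = I \<rightarrow>\<^sub>E V - {v}"
  have "star_weight E k V w = (\<Sum>g\<in>P. \<Sum>f\<in>{f \<in> I \<rightarrow>\<^sub>E V. restrict (r \<circ> f) I = g}.
      of_bool (star_map E k f) * (\<Prod>i<k. w (f i)))"
    unfolding star_weight_def I_def[symmetric]
  proof (rule sum.group[symmetric])
    show "finite (I \<rightarrow>\<^sub>E V)" "finite P"
      unfolding P_def I_def using \<open>finite V\<close> by (auto intro!: finite_PiE)
    show "(\<lambda>f. restrict (r \<circ> f) I) ` (I \<rightarrow>\<^sub>E V) \<subseteq> P"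
      using assms(1-4) by (fastforce simp: P_def r_def PiE_iff)
  qed
  also have "\<dots> = (\<Sum>g\<in>P. \<Sum>f\<in>F g. of_bool (star_map E k f) * (\<Prod>i<k. w (f i)))"
  proof (rule sum.cong[OF refl], rule sum.cong)
    fix g assume "g \<in> P"
    then have g: "g \<in> extensional I" by (simp add: P_def PiE_iff)
    have "restrict (r \<circ> f) I = g \<longleftrightarrow> (\<forall>i\<in>I. r (f i) = g i)" for f
    proof
      assume "restrict (r \<circ> f) I = g"
      then show "\<forall>i\<in>I. r (f i) = g i" by auto
    next
      assume *: "\<forall>i\<in>I. r (f i) = g i"
      show "restrict (r \<circ> f) I = g"
        by (rule extensionalityI[OF restrict_extensional g]) (use * in simp)
    qed
    then show "{f \<in> I \<rightarrow>\<^sub>E V. restrict (r \<circ> f) I = g} = F g"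
      by (intro set_eqI) (simp add: F_def PiE_iff, blast)
  qed simp
  also have "\<dots> \<le> (\<Sum>g\<in>P. (l * of_bool (star_map E k g) + (1 - l) * of_bool (star_map E' k g))
      * (\<Prod>i<k. W (g i)))"
    by (rule sum_mono) (use fiber in \<open>simp add: P_def\<close>)
  also have "\<dots> = l * star_weight E k (V - {v}) W + (1 - l) * star_weight E' k (V - {v}) W"
    unfolding star_weight_def P_def I_def
    by (simp add: sum_distrib_left sum.distrib[symmetric] algebra_simps)
  finally show "star_weight E k V w \<le> \<dots>" .
qed

section \<open>Tournaments\<close>

text \<open>
  Removing a vertex \<open>t\<close> of maximal weight makes the induction work: every arc at \<open>t\<close>, whatever its
  direction, contributes at most as much as one pointing to \<open>t\<close>.\<close>

lemma tournament_weight_le: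
  fixes w :: "'a \<Rightarrow> real"
  assumes c: "\<And>x. 0 \<le> x \<Longrightarrow> x \<le> 1 \<Longrightarrow> x * (1 - x) ^ m \<le> c * (1 - x ^ Suc m)"
    and "m > 0"
    and E: "\<And>a b. (a, b) \<in> E \<Longrightarrow> (b, a) \<notin> E"
    and w: "\<And>x. 0 \<le> w x"
    and "finite V"
  shows "(\<Sum>(a, b)\<in>E \<inter> V \<times> V. w a * w b ^ m) \<le> c * sum w V ^ Suc m"
  using \<open>finite V\<close>
proof (induction "card V" arbitrary: V)
  case 0
  then show ?case by simp
next
  case (Suc n)
  then have "V \<noteq> {}" "finite V" by auto
  then have "Max (w ` V) \<in> w ` V" by (intro Max_in) auto
  then obtain t where t: "t \<in> V" "w t = Max (w ` V)" by (metis imageE)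
  have max: "w x \<le> w t" if "x \<in> V" for x
    using t that \<open>finite V\<close> by simp
  define U where "U = V - {t}"
  have U: "finite U" "V = insert t U" "t \<notin> U" using t Suc by (auto simp: U_def)
  define h where "h = (\<lambda>(a, b). w a * w b ^ m)"
  define Out where "Out = {x \<in> U. (t, x) \<in> E}"
  define Inn where "Inn = {x \<in> U. (x, t) \<in> E}"
  have OI: "finite Out" "finite Inn" "Out \<inter> Inn = {}" using U E by (auto simp: Out_def Inn_def)
  have "(t, t) \<notin> E" using E by blast
  then have split: "E \<inter> V \<times> V = E \<inter> U \<times> U \<union> ({t} \<times> Out \<union> Inn \<times> {t})"
    unfolding U(2) Out_def Inn_def by auto
  have "(\<Sum>e\<in>E \<inter> V \<times> V. h e) = (\<Sum>e\<in>E \<inter> U \<times> U. h e) + ((\<Sum>e\<in>{t} \<times> Out. h e) + (\<Sum>e\<in>Inn \<times> {t}. h e))"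
    unfolding split using U OI
    by (subst sum.union_disjoint, simp, simp, force simp: Out_def Inn_def)
      (subst sum.union_disjoint, auto simp: Out_def Inn_def)
  also have "(\<Sum>e\<in>{t} \<times> Out. h e) = (\<Sum>x\<in>Out. w t * w x ^ m)"
    using sum.cartesian_product[of "\<lambda>a b. w a * w b ^ m" Out "{t}"] by (simp add: h_def)
  also have "(\<Sum>e\<in>Inn \<times> {t}. h e) = (\<Sum>x\<in>Inn. w x * w t ^ m)"
    using sum.cartesian_product[of "\<lambda>a b. w a * w b ^ m" "{t}" Inn] by (simp add: h_def)
  \<comment> \<open>Reversing the arcs that leave \<open>t\<close> does not decrease the sum, as \<open>t\<close> is heaviest.\<close>
  also have "(\<Sum>x\<in>Out. w t * w x ^ m) \<le> (\<Sum>x\<in>Out. w x * w t ^ m)"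
  proof (rule sum_mono)
    fix x assume "x \<in> Out"
    then have "w x \<le> w t" using max by (auto simp: Out_def U_def)
    then have "w x ^ (m - 1) \<le> w t ^ (m - 1)" using w by (simp add: power_mono)
    then have "(w t * w x) * w x ^ (m - 1) \<le> (w t * w x) * w t ^ (m - 1)"
      using w by (intro mult_left_mono) auto
    then show "w t * w x ^ m \<le> w x * w t ^ m"
      using \<open>m > 0\<close> by (cases m) (auto simp: mult_ac)
  qed
  also have "(\<Sum>e\<in>E \<inter> U \<times> U. h e) + ((\<Sum>x\<in>Out. w x * w t ^ m) + (\<Sum>x\<in>Inn. w x * w t ^ m))
      = (\<Sum>e\<in>E \<inter> U \<times> U. h e) + sum w (Out \<union> Inn) * w t ^ m"
    using OI by (simp add: sum.union_disjoint sum_distrib_right distrib_right)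
  also have "\<dots> \<le> c * sum w U ^ Suc m + sum w U * w t ^ m"
  proof (intro add_mono mult_right_mono)
    show "(\<Sum>e\<in>E \<inter> U \<times> U. h e) \<le> c * sum w U ^ Suc m"
      unfolding h_def by (rule Suc.hyps) (use Suc U in auto)
    show "sum w (Out \<union> Inn) \<le> sum w U"
      by (rule sum_mono2) (use U w in \<open>auto simp: Out_def Inn_def\<close>)
  qed (use w in auto)
  also have "\<dots> \<le> c * sum w V ^ Suc m"
  proof -
    define y where "y = sum w U"
    define s where "s = y + w t"
    have y: "0 \<le> y" using w by (simp add: y_def sum_nonneg)
    have s: "sum w V = s" using U by (simp add: s_def y_def)
    show ?thesis
    proof (cases "s = 0")
      case True
      then have "y = 0" using y w[of t] by (simp add: s_def)
      then show ?thesis using True s by (simp add: y_def)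
    next
      case False
      then have "s > 0" using y w[of t] by (simp add: s_def)
      \<comment> \<open>The hypothesis on \<open>c\<close> at the fraction of the weight outside \<open>t\<close>, scaled by \<open>s ^ Suc m\<close>.\<close>
      have "y / s * (1 - y / s) ^ m \<le> c * (1 - (y / s) ^ Suc m)"
        by (rule c) (use y \<open>s > 0\<close> w[of t] in \<open>auto simp: s_def\<close>)
      moreover have "1 - y / s = w t / s" using \<open>s > 0\<close> by (simp add: s_def field_simps)
      ultimately have le: "(y / s * (w t / s) ^ m) * s ^ Suc m \<le> (c * (1 - (y / s) ^ Suc m)) * s ^ Suc m"
        using \<open>s > 0\<close> by (intro mult_right_mono) auto
      have "(y / s * (w t / s) ^ m) * s ^ Suc m = y * w t ^ m"
        using \<open>s > 0\<close> by (simp add: power_divide)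
      moreover have "(c * (1 - (y / s) ^ Suc m)) * s ^ Suc m = c * (s ^ Suc m - y ^ Suc m)"
        using \<open>s > 0\<close> by (simp add: power_divide field_simps)
      ultimately have "y * w t ^ m \<le> c * (s ^ Suc m - y ^ Suc m)" using le by linarith
      then show ?thesis unfolding s y_def[symmetric] by (simp add: algebra_simps)
    qed
  qed
  finally show ?case by (simp add: h_def)
qed

text \<open>
  Distinct leaves are non-adjacent, so when all vertices are pairwise adjacent a star has just one
  leaf, repeated \<open>m\<close> times, and is determined by an arc.\<close>

lemma star_weight_le_tournament:
  fixes w :: "'a \<Rightarrow> real"
  assumes adj: "\<And>a b. a \<in> V \<Longrightarrow> b \<in> V \<Longrightarrow> a \<noteq> b \<Longrightarrow> (a, b) \<in> E \<or> (b, a) \<in> E"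
    and w: "\<And>x. 0 \<le> w x" and "finite V" and "m > 0"
  shows "star_weight E (Suc m) V w \<le> (\<Sum>(a, b)\<in>E \<inter> V \<times> V. w a * w b ^ m)"
proof -
  define P where "P = {f \<in> {..<Suc m} \<rightarrow>\<^sub>E V. star_map E (Suc m) f}"
  have leaf: "f i = f 1" if "f \<in> P" "i \<in> {1..<Suc m}" for f i
    using that \<open>m > 0\<close> adj[of "f i" "f 1"] by (auto simp: P_def star_map_def PiE_iff)
  have fin: "finite ({..<Suc m} \<rightarrow>\<^sub>E V)" using \<open>finite V\<close> by (intro finite_PiE) auto
  have val: "(\<Prod>i<Suc m. w (f i)) = w (f 0) * w (f 1) ^ m" if "f \<in> P" for f
  proof -
    have "(\<Prod>i<Suc m. w (f i)) = w (f 0) * (\<Prod>i<m. w (f (Suc i)))"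
      by (rule prod.lessThan_Suc_shift)
    also have "(\<Prod>i<m. w (f (Suc i))) = (\<Prod>i<m. w (f 1))"
    proof (rule prod.cong[OF refl])
      fix i assume "i \<in> {..<m}"
      then show "w (f (Suc i)) = w (f 1)" using leaf[OF that, of "Suc i"] by simp
    qed
    finally show ?thesis by simp
  qed
  have inj: "inj_on (\<lambda>f. (f 0, f 1)) P"
  proof (rule inj_onI)
    fix f g assume fg: "f \<in> P" "g \<in> P" "(f 0, f 1) = (g 0, g 1)"
    show "f = g"
    proof (rule extensionalityI)
      show "f \<in> extensional {..<Suc m}" "g \<in> extensional {..<Suc m}"
        using fg by (auto simp: P_def PiE_iff)
      fix i assume "i \<in> {..<Suc m}"
      then show "f i = g i"
        using fg leaf[of f i] leaf[of g i] by (cases "i = 0") auto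
    qed
  qed
  have "star_weight E (Suc m) V w = (\<Sum>f\<in>P. w (f 0) * w (f 1) ^ m)"
  proof -
    have "star_weight E (Suc m) V w = (\<Sum>f\<in>P. \<Prod>i<Suc m. w (f i))"
      unfolding star_weight_def P_def
      by (rule sum.mono_neutral_cong_right) (use fin in auto)
    then show ?thesis using val by simp
  qed
  also have "\<dots> = (\<Sum>(a, b)\<in>(\<lambda>f. (f 0, f 1)) ` P. w a * w b ^ m)"
    using inj by (simp add: sum.reindex)
  also have "\<dots> \<le> (\<Sum>(a, b)\<in>E \<inter> V \<times> V. w a * w b ^ m)"
    by (rule sum_mono2) (use \<open>finite V\<close> \<open>m > 0\<close> w in \<open>auto simp: P_def star_map_def PiE_iff\<close>)
  finally show ?thesis .
qed

text \<open>
  Merging non-adjacent vertices preserves the total weight and the absence of antiparallel arcs, so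
  induction on the number of vertices reduces to the case of a tournament.\<close>

lemma star_weight_le:
  fixes w :: "'a \<Rightarrow> real"
  assumes c: "\<And>x. 0 \<le> x \<Longrightarrow> x \<le> 1 \<Longrightarrow> x * (1 - x) ^ m \<le> c * (1 - x ^ Suc m)"
    and "m > 0"
    and "\<And>a b. (a, b) \<in> E \<Longrightarrow> (b, a) \<notin> E"
    and "\<And>x. 0 \<le> w x"
    and "finite V"
  shows "star_weight E (Suc m) V w \<le> c * sum w V ^ Suc m"
  using assms(3-)
proof (induction "card V" arbitrary: V E w rule: less_induct)
  case less
  show ?case
  proof (cases "\<forall>a\<in>V. \<forall>b\<in>V. a \<noteq> b \<longrightarrow> (a, b) \<in> E \<or> (b, a) \<in> E")
    case True
    have "star_weight E (Suc m) V w \<le> (\<Sum>(a, b)\<in>E \<inter> V \<times> V. w a * w b ^ m)"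
      by (rule star_weight_le_tournament) (use True less.prems(2,3) \<open>m > 0\<close> in auto)
    also have "\<dots> \<le> c * sum w V ^ Suc m"
      by (rule tournament_weight_le[OF c \<open>m > 0\<close> less.prems])
    finally show ?thesis .
  next
    case False
    then obtain u v where uv: "u \<in> V" "v \<in> V" "u \<noteq> v" "(u, v) \<notin> E" "(v, u) \<notin> E" by blast
    define W where "W = w(u := w u + w v)"
    define E' where "E' = {(a, b). ((if a = u then v else a), (if b = u then v else b)) \<in> E}"
    obtain l where l: "0 \<le> l" "l \<le> 1"
      "star_weight E (Suc m) V w
        \<le> l * star_weight E (Suc m) (V - {v}) W + (1 - l) * star_weight E' (Suc m) (V - {v}) W"
      unfolding W_def E'_def
      by (rule star_weight_merge[where w = w, OF less.prems(3) uv less.prems(2) zero_less_Suc])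
    have "sum W (V - {v}) = W u + sum W (V - {v} - {u})"
      using uv less.prems(3) by (intro sum.remove) auto
    also have "sum W (V - {v} - {u}) = sum w (V - {v} - {u})"
      by (rule sum.cong) (auto simp: W_def)
    also have "W u + \<dots> = w v + (w u + sum w (V - {v} - {u}))" by (simp add: W_def)
    also have "w u + sum w (V - {v} - {u}) = sum w (V - {v})"
      using uv less.prems(3) by (intro sum.remove[symmetric]) auto
    also have "w v + \<dots> = sum w V"
      using uv less.prems(3) by (intro sum.remove[symmetric]) auto
    finally have sumW: "sum W (V - {v}) = sum w V" .
    have W: "0 \<le> W x" for x using less.prems(2) by (simp add: W_def)
    have E': "(a, b) \<in> E' \<Longrightarrow> (b, a) \<notin> E'" for a b
      unfolding E'_def mem_Collect_eq case_prod_conv by (rule less.prems(1))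
    have card: "card (V - {v}) < card V"
      using uv less.prems(3) by (intro card_Diff1_less) auto
    have 1: "star_weight E (Suc m) (V - {v}) W \<le> c * sum w V ^ Suc m"
      unfolding sumW[symmetric] by (rule less.hyps[OF card less.prems(1) W]) (simp_all add: less.prems(3))
    have 2: "star_weight E' (Suc m) (V - {v}) W \<le> c * sum w V ^ Suc m"
      unfolding sumW[symmetric]
      by (rule less.hyps[OF card E' W]) (simp_all add: less.prems(3))
    note l(3)
    also have "l * star_weight E (Suc m) (V - {v}) W + (1 - l) * star_weight E' (Suc m) (V - {v}) W
        \<le> l * (c * sum w V ^ Suc m) + (1 - l) * (c * sum w V ^ Suc m)"
      using l 1 2 by (intro add_mono mult_left_mono) auto
    finally show ?thesis by (simp add: algebra_simps)
  qed
qed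

section \<open>Induced stars and the star weight\<close>

lemma induced_copies_directed_star:
  assumes G: "oriented_digraph G" and "k > 0"
  shows "induced_copies (directed_star k) G =
    {S. S \<subseteq> pverts G \<and> card S = k \<and> (\<exists>c\<in>S. parcs G \<inter> S \<times> S = {c} \<times> (S - {c}))}"
proof -
  interpret oriented_digraph G by (rule G)
  have "digraph_iso (with_proj G \<restriction> S) (with_proj (directed_star k)) \<longleftrightarrow>
      (\<exists>c\<in>S. parcs G \<inter> S \<times> S = {c} \<times> (S - {c}))" if "S \<subseteq> pverts G" "card S = k" for S
  proof
    assume "digraph_iso (with_proj G \<restriction> S) (with_proj (directed_star k))"
    then obtain h where h: "pre_digraph.digraph_isomorphism (with_proj G \<restriction> S) h"
      "with_proj (directed_star k) = app_iso h (with_proj G \<restriction> S)"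
      unfolding digraph_iso_def by blast
    define b where "b = iso_verts h"
    have wf: "wf_digraph (with_proj G \<restriction> S)" using h(1) by (simp add: pre_digraph.digraph_isomorphism_def)
    have inj: "inj_on b S"
      using h(1) by (simp add: pre_digraph.digraph_isomorphism_def b_def)
    have img: "b ` S = {..<k}"
      using arg_cong[OF h(2), of verts] by (simp add: b_def directed_star_def)
    have "arcs_ends (with_proj G \<restriction> S) = parcs G \<inter> S \<times> S"
      by (auto simp: arcs_ends_conv)
    moreover have "arcs_ends (with_proj (directed_star k)) =
        (\<lambda>(u, v). (b u, b v)) ` arcs_ends (with_proj G \<restriction> S)"
      unfolding h(2) b_def by (rule wf_digraph.arcs_ends_app_iso_eq[OF wf h(1)])
    ultimately have ends: "{0} \<times> {1..<k} = (\<lambda>(u, v). (b u, b v)) ` (parcs G \<inter> S \<times> S)"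
      by (simp add: directed_star_def)
    have "0 \<in> b ` S" using img \<open>k > 0\<close> by auto
    then obtain c where c: "c \<in> S" "b c = 0" by auto
    have b0: "b x = 0 \<longleftrightarrow> x = c" if "x \<in> S" for x
      using inj c that by (metis inj_onD)
    have "(x, y) \<in> parcs G \<longleftrightarrow> x = c \<and> y \<noteq> c" if xy: "x \<in> S" "y \<in> S" for x y
    proof
      assume "(x, y) \<in> parcs G"
      then have "(b x, b y) \<in> {0} \<times> {1..<k}"
        unfolding ends using xy by (intro image_eqI[of _ _ "(x, y)"]) auto
      then have "b x = 0" "b y \<noteq> 0" by auto
      then show "x = c \<and> y \<noteq> c" using b0[OF xy(1)] b0[OF xy(2)] by simp
    next
      assume *: "x = c \<and> y \<noteq> c"
      have "b y < k" using img xy by blast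
      moreover have "b y \<noteq> 0" using b0 xy * by simp
      ultimately have "(b x, b y) \<in> {0} \<times> {1..<k}" using * c by auto
      then obtain x' y' where "(x', y') \<in> parcs G" "x' \<in> S" "y' \<in> S" "b x = b x'" "b y = b y'"
        unfolding ends by auto
      then show "(x, y) \<in> parcs G" using inj xy by (metis inj_onD)
    qed
    then show "\<exists>c\<in>S. parcs G \<inter> S \<times> S = {c} \<times> (S - {c})" using c(1) by (intro bexI[of _ c]) auto
  next
    assume "\<exists>c\<in>S. parcs G \<inter> S \<times> S = {c} \<times> (S - {c})"
    then obtain c where c: "c \<in> S" "parcs G \<inter> S \<times> S = {c} \<times> (S - {c})" by blast
    have "finite S" using that \<open>k > 0\<close> card_ge_0_finite by blast
    then have "card (S - {c}) = card {1..<k}" using c that by simp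
    then obtain b0 where b0: "bij_betw b0 (S - {c}) {1..<k}"
      using finite_same_card_bij[of "S - {c}" "{1..<k}"] \<open>finite S\<close> by auto
    define b where "b = b0(c := 0)"
    have img': "b ` (S - {c}) = {1..<k}" using b0 by (auto simp: b_def bij_betw_def)
    have "b ` S = insert (b c) (b ` (S - {c}))" using c by auto
    also have "\<dots> = {..<k}" unfolding img' using \<open>k > 0\<close> by (auto simp: b_def)
    finally have img: "b ` S = {..<k}" .
    then have inj: "inj_on b S" using that(2) \<open>finite S\<close> by (simp add: eq_card_imp_inj_on)
    define h where "h = \<lparr>iso_verts = b, iso_arcs = map_prod b b, iso_head = snd, iso_tail = fst\<rparr>"
    have "{e \<in> parcs G. fst e \<in> S \<and> snd e \<in> S} = parcs G \<inter> S \<times> S" by auto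
    then have arcs: "{e \<in> parcs G. fst e \<in> S \<and> snd e \<in> S} = {c} \<times> (S - {c})"
      unfolding c(2) .
    have "wf_digraph (with_proj G \<restriction> S)" by unfold_locales auto
    moreover have "inj_on (map_prod b b) ({c} \<times> (S - {c}))"
      by (rule inj_on_subset[OF map_prod_inj_on[OF inj inj]]) (use c(1) in auto)
    ultimately have "pre_digraph.digraph_isomorphism (with_proj G \<restriction> S) h"
      using inj arcs by (auto simp: pre_digraph.digraph_isomorphism_def h_def)
    moreover have "map_prod b b ` ({c} \<times> (S - {c})) = {b c} \<times> b ` (S - {c})"
      by force
    then have "map_prod b b ` ({c} \<times> (S - {c})) = {0} \<times> {1..<k}"
      unfolding img' by (simp add: b_def)
    then have "with_proj (directed_star k) = app_iso h (with_proj G \<restriction> S)"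
      using img arcs by (intro pre_digraph.equality) (auto simp: directed_star_def h_def)
    ultimately show "digraph_iso (with_proj G \<restriction> S) (with_proj (directed_star k))"
      unfolding digraph_iso_def by blast
  qed
  then show ?thesis by (auto simp: induced_copies_def directed_star_def)
qed

text \<open>
  The leaves of each induced copy can be ordered in \<open>m!\<close> ways, and the resulting maps are distinct
  because they determine the vertex set of the copy as their range.\<close>

lemma induced_copies_directed_star_le_star_weight:
  assumes G: "oriented_digraph G"
  shows "fact m * real (card (induced_copies (directed_star (Suc m)) G))
    \<le> star_weight (parcs G) (Suc m) (pverts G) (\<lambda>_. 1)"
proof -
  interpret oriented_digraph G by (rule G)
  define C where "C = induced_copies (directed_star (Suc m)) G"
  define P where "P = {f \<in> {..<Suc m} \<rightarrow>\<^sub>E pverts G. star_map (parcs G) (Suc m) f}"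
  define Q where "Q = (\<lambda>S. {f \<in> P. f ` {..<Suc m} = S})"
  have fin: "finite ({..<Suc m} \<rightarrow>\<^sub>E pverts G)"
    using pair_finite_verts by (intro finite_PiE) auto
  then have finP: "finite P" by (simp add: P_def)
  have finC: "finite C" unfolding C_def by (rule finite_induced_copies(1)[OF pair_finite_verts])
  have Q: "fact m \<le> card (Q S)" if "S \<in> C" for S
  proof -
    obtain c where S: "S \<subseteq> pverts G" "card S = Suc m" "c \<in> S"
      "parcs G \<inter> S \<times> S = {c} \<times> (S - {c})"
      using \<open>S \<in> C\<close> by (auto simp: C_def induced_copies_directed_star[OF G])
    have "finite S" using S(2) card_ge_0_finite by force
    then have "card {1..<Suc m} = card (S - {c})" using S by simp
    then obtain b0 where b0: "bij_betw b0 {1..<Suc m} (S - {c})"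
      using finite_same_card_bij[of "{1..<Suc m}" "S - {c}"] \<open>finite S\<close> by auto
    define b where "b = b0(0 := c)"
    have b: "bij_betw b {1..<Suc m} (S - {c})"
      using b0 by (rule bij_betw_cong[THEN iffD1, rotated]) (auto simp: b_def)
    have range: "{..<Suc m} = insert 0 {1..<Suc m}" by auto
    have bb: "bij_betw b {..<Suc m} S"
    proof -
      have img: "b ` {1..<Suc m} = S - {c}" and "inj_on b {1..<Suc m}"
        using b by (auto simp: bij_betw_def)
      moreover have "b 0 = c" by (simp add: b_def)
      moreover have "{1..<Suc m} - {0} = {1..<Suc m}" by auto
      ultimately have "inj_on b {..<Suc m}" unfolding range inj_on_insert by simp
      moreover have "b ` {..<Suc m} = S"
        unfolding range image_insert img using S(3) \<open>b 0 = c\<close> by auto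
      ultimately show ?thesis by (simp add: bij_betw_def)
    qed
    \<comment> \<open>The orderings are \<open>b\<close> composed with the permutations of the positions \<open>1, \<dots>, m\<close>.\<close>
    define F where "F = (\<lambda>p. restrict (b \<circ> p) {..<Suc m})"
    have "inj_on F {p. p permutes {1..<Suc m}}"
    proof (rule inj_onI, rule ext)
      fix p q i
      assume pq: "p \<in> {p. p permutes {1..<Suc m}}" "q \<in> {p. p permutes {1..<Suc m}}" "F p = F q"
      show "p i = q i"
      proof (cases "i \<in> {1..<Suc m}")
        case True
        then have "b (p i) = b (q i)" using fun_cong[OF pq(3), of i] by (simp add: F_def)
        moreover have "p i \<in> {1..<Suc m}" "q i \<in> {1..<Suc m}"
          using pq True permutes_in_image by (metis mem_Collect_eq)+
        ultimately show ?thesis using b by (metis bij_betw_def inj_onD)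
      next
        case False
        then show ?thesis using pq by (metis mem_Collect_eq permutes_not_in)
      qed
    qed
    moreover have "F ` {p. p permutes {1..<Suc m}} \<subseteq> Q S"
    proof
      fix f assume "f \<in> F ` {p. p permutes {1..<Suc m}}"
      then obtain p where p: "p permutes {1..<Suc m}" "f = F p" by auto
      have p0: "p 0 = 0" using p(1) permutes_not_in[of p "{1..<Suc m}" 0] by simp
      have "p permutes {..<Suc m}" by (rule permutes_subset[OF p(1)]) auto
      then have "f ` {..<Suc m} = b ` {..<Suc m}"
        unfolding p(2) F_def by (simp add: image_image[symmetric, of b p] permutes_image del: image_image)
      then have img: "f ` {..<Suc m} = S" using bb by (simp add: bij_betw_def)
      have leaf: "f i \<in> S - {c}" if "i \<in> {1..<Suc m}" for i
        using b that permutes_in_image[OF p(1), of i] by (auto simp: p(2) F_def bij_betw_def)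
      have centre: "f 0 = c" by (simp add: p(2) F_def p0 b_def)
      have arc: "(x, y) \<in> parcs G \<longleftrightarrow> x = c \<and> y \<noteq> c" if "x \<in> S" "y \<in> S" for x y
        using S(4) that by blast
      have "star_map (parcs G) (Suc m) f"
        unfolding star_map_def centre
      proof (intro conjI ballI)
        fix i assume "i \<in> {1..<Suc m}"
        then show "(c, f i) \<in> parcs G" using leaf[of i] arc S(3) by simp
      next
        fix i j assume "i \<in> {1..<Suc m}" "j \<in> {1..<Suc m}"
        then show "(f i, f j) \<notin> parcs G" using leaf[of i] leaf[of j] arc by simp
      qed
      moreover have "f \<in> {..<Suc m} \<rightarrow>\<^sub>E pverts G"
        using img S(1) by (auto simp: p(2) F_def PiE_iff)
      ultimately show "f \<in> Q S" using img by (simp add: Q_def P_def)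
    qed
    ultimately have "card {p. p permutes {1..<Suc m}} \<le> card (Q S)"
      by (rule card_inj_on_le) (use finP in \<open>simp add: Q_def\<close>)
    then show ?thesis using card_permutations[of "{1..<Suc m}" m] by simp
  qed
  have "fact m * card C \<le> (\<Sum>S\<in>C. card (Q S))"
    using sum_mono[of C "\<lambda>_. fact m" "\<lambda>S. card (Q S)"] Q by (simp add: mult.commute)
  also have "\<dots> = card (\<Union>S\<in>C. Q S)"
    by (rule card_UN_disjoint[symmetric]) (use finC finP in \<open>auto simp: Q_def\<close>)
  also have "\<dots> \<le> card P"
    by (rule card_mono[OF finP]) (auto simp: Q_def)
  finally have "real (fact m * card C) \<le> real (card P)" by (simp only: of_nat_le_iff)
  also have "real (card P) = star_weight (parcs G) (Suc m) (pverts G) (\<lambda>_. 1)"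
  proof -
    have "star_weight (parcs G) (Suc m) (pverts G) (\<lambda>_. 1) = (\<Sum>f\<in>P. 1)"
      unfolding star_weight_def P_def
      by (rule sum.mono_neutral_cong_right) (use fin in auto)
    then show ?thesis by simp
  qed
  finally show ?thesis by (simp add: C_def)
qed

section \<open>Stars in the iterated construction\<close>

text \<open>
  The copies counted by the product have their centre in the inner part and all leaves in the outer,
  independent part, so they are not among the copies inside the inner part.\<close>

lemma card_induced_copies_iterated_digraph:
  assumes "k \<ge> 2" "0 < x" "x < 1" "n > 1"
  defines "a \<equiv> nat \<lfloor>x * real n\<rfloor>"
  shows "a * (n - a choose (k - 1)) + card (induced_copies (directed_star k) (iterated_digraph x a))
    \<le> card (induced_copies (directed_star k) (iterated_digraph x n))"
proof -
  define A where "A = (\<lambda>(c, L). insert c L) ` ({..<a} \<times> {L. L \<subseteq> {a..<n} \<and> card L = k - 1})"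
  define B where "B = induced_copies (directed_star k) (iterated_digraph x a)"
  define C where "C = induced_copies (directed_star k) (iterated_digraph x n)"
  have "x * real n < 1 * real n" using assms by (intro mult_strict_right_mono) auto
  then have "a < n" using assms unfolding a_def by (simp add: nat_less_iff floor_less_iff)
  have arcs: "parcs (iterated_digraph x n) = {..<a} \<times> {a..<n} \<union> parcs (iterated_digraph x a)"
    using assms by (subst iterated_digraph.simps) (simp add: a_def Let_def)
  have sub: "parcs (iterated_digraph x a) \<subseteq> {..<a} \<times> {..<a}"
    using parcs_iterated_digraph[of x a] by fastforce
  have star: "S \<in> induced_copies (directed_star k) (iterated_digraph x l) \<longleftrightarrow> S \<subseteq> {..<l} \<and> card S = k
      \<and> (\<exists>c\<in>S. parcs (iterated_digraph x l) \<inter> S \<times> S = {c} \<times> (S - {c}))" for S l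
    using assms by (simp add: induced_copies_directed_star[OF oriented_iterated_digraph])
  have "A \<subseteq> C"
  proof
    fix S assume "S \<in> A"
    then obtain c L where S: "S = insert c L" "c < a" "L \<subseteq> {a..<n}" "card L = k - 1"
      by (auto simp: A_def)
    have "c \<notin> L" "finite L" using S by (auto intro: finite_subset)
    then have "card S = k" using S assms by simp
    moreover have "S \<subseteq> {..<n}" using S \<open>a < n\<close> by auto
    moreover have "parcs (iterated_digraph x n) \<inter> S \<times> S = {c} \<times> (S - {c})"
    proof -
      have "(c, c) \<notin> parcs (iterated_digraph x a)"
        using parcs_iterated_digraph[of x a] by blast
      then show ?thesis unfolding arcs S(1) using S sub \<open>c \<notin> L\<close> by fastforce
    qed
    ultimately show "S \<in> C" unfolding C_def star using S(1) by blast
  qed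
  moreover have "B \<subseteq> C"
  proof
    fix S assume "S \<in> B"
    then have S: "S \<subseteq> {..<a}" "card S = k"
      "\<exists>c\<in>S. parcs (iterated_digraph x a) \<inter> S \<times> S = {c} \<times> (S - {c})"
      unfolding B_def star by simp_all
    have "({..<a} \<times> {a..<n}) \<inter> S \<times> S = {}" using S(1) by auto
    then have "parcs (iterated_digraph x n) \<inter> S \<times> S = parcs (iterated_digraph x a) \<inter> S \<times> S"
      unfolding arcs by blast
    moreover have "S \<subseteq> {..<n}" using S(1) \<open>a < n\<close> by auto
    ultimately show "S \<in> C" unfolding C_def star using S(2,3) by simp
  qed
  moreover have "A \<inter> B = {}"
  proof -
    have "\<not> S \<subseteq> {..<a}" if S_in_A: "S \<in> A" for S
    proof -
      obtain c L where S: "S = insert c L" "L \<subseteq> {a..<n}" "card L = k - 1"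
        using S_in_A by (auto simp: A_def)
      then have "L \<noteq> {}" using assms by auto
      then show ?thesis using S by fastforce
    qed
    moreover have "S \<subseteq> {..<a}" if "S \<in> B" for S using that unfolding B_def star by blast
    ultimately show ?thesis by blast
  qed
  moreover have fin: "finite C" "finite B" unfolding B_def C_def by (rule finite_induced_copies(1), simp)+
  moreover have "card A = a * (n - a choose (k - 1))"
  proof -
    have decomp: "L \<inter> {..<a} = {}" "L \<inter> {a..} = L" if "L \<subseteq> {a..<n}" for L
      using that by auto
    have "inj_on (\<lambda>(c, L). insert c L) ({..<a} \<times> {L. L \<subseteq> {a..<n} \<and> card L = k - 1})"
      by (rule inj_on_inverseI[where g = "\<lambda>S. (the_elem (S \<inter> {..<a}), S \<inter> {a..})"])
        (simp add: case_prod_unfold decomp mem_Times_iff)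
    then have "card A = card ({..<a} \<times> {L. L \<subseteq> {a..<n} \<and> card L = k - 1})"
      unfolding A_def by (rule card_image)
    then show ?thesis by (simp add: card_cartesian_product n_subsets)
  qed
  ultimately have "a * (n - a choose (k - 1)) + card B = card (A \<union> B)"
    by (subst card_Un_disjoint) (auto intro: finite_subset)
  also have "\<dots> \<le> card C"
    by (rule card_mono) (use fin \<open>A \<subseteq> C\<close> \<open>B \<subseteq> C\<close> in auto)
  finally show ?thesis by (simp add: B_def C_def)
qed

lemma binomial_div_power_tendsto:
  fixes b :: "nat \<Rightarrow> nat"
  assumes "(\<lambda>n. real (b n) / real n) \<longlonglongrightarrow> y"
  shows "(\<lambda>n. real (b n choose m) / real n ^ m) \<longlonglongrightarrow> y ^ m / fact m"
proof -
  have "(\<lambda>n. real (b n) / real n - real i * (1 / real n)) \<longlonglongrightarrow> y - real i * 0" for i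
    by (intro tendsto_intros assms lim_1_over_n)
  then have "(\<lambda>n. (\<Prod>i<m. real (b n) / real n - real i * (1 / real n)) / fact m)
      \<longlonglongrightarrow> (\<Prod>i<m. y - real i * 0) / fact m"
    by (intro tendsto_divide tendsto_prod tendsto_const) simp_all
  moreover have "(\<Prod>i<m. real (b n) / real n - real i * (1 / real n)) / fact m
      = real (b n choose m) / real n ^ m" for n
  proof -
    have "(\<Prod>i<m. real (b n) / real n - real i * (1 / real n)) = (\<Prod>i<m. (real (b n) - real i) / real n)"
      by (simp add: diff_divide_distrib)
    also have "\<dots> = (\<Prod>i<m. real (b n) - real i) / real n ^ m"
      by (simp add: prod_dividef)
    finally show ?thesis
      by (simp add: binomial_gbinomial gbinomial_prod_rev atLeast0LessThan mult.commute)
  qed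
  ultimately show ?thesis by simp
qed

text \<open>
  For \<open>g\<close> strictly below the fixed point of the recursion for the leading coefficient, the recursion
  gains for all \<open>n \<ge> m\<close>, so the constant \<open>C\<close> only has to absorb the finitely many smaller \<open>n\<close>. The strict
  inequality is what makes error terms of lower order unnecessary.\<close>

lemma iterated_digraph_copies_lower:
  assumes "k \<ge> 2" "0 < x" "x < 1"
    and g: "g < x * (1 - x) ^ (k - 1) / fact (k - 1) / (1 - x ^ k)"
  obtains C where
    "\<And>n. g * real n ^ k - C \<le> real (card (induced_copies (directed_star k) (iterated_digraph x n)))"
proof -
  define N where "N = (\<lambda>n. card (induced_copies (directed_star k) (iterated_digraph x n)))"
  define a where "a = (\<lambda>n. nat \<lfloor>x * real n\<rfloor>)"
  have k: "k = Suc (k - 1)" using assms(1) by simp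
  have a_lt: "a n < n" if "n > 0" for n
  proof -
    have "x * real n < 1 * real n" using assms that by (intro mult_strict_right_mono) auto
    then show ?thesis using that assms unfolding a_def by (simp add: nat_less_iff floor_less_iff)
  qed
  have a_le: "real (a n) \<le> x * real n" "x * real n - 1 \<le> real (a n)" for n
  proof -
    have "0 \<le> x * real n" using assms by simp
    then show "real (a n) \<le> x * real n" "x * real n - 1 \<le> real (a n)"
      unfolding a_def by linarith+
  qed
  have a_lim: "(\<lambda>n. real (a n) / real n) \<longlonglongrightarrow> x"
  proof (rule real_tendsto_sandwich)
    show "\<forall>\<^sub>F n in sequentially. x - 1 / real n \<le> real (a n) / real n"
      using eventually_gt_at_top[of "0::nat"]
    proof eventually_elim
      case (elim n)
      have "x - 1 / real n = (x * real n - 1) / real n" using elim by (simp add: field_simps)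
      also have "\<dots> \<le> real (a n) / real n" by (rule divide_right_mono[OF a_le(2)]) simp
      finally show ?case .
    qed
    show "\<forall>\<^sub>F n in sequentially. real (a n) / real n \<le> x"
      using eventually_gt_at_top[of "0::nat"]
      by eventually_elim (use a_le(1) in \<open>auto simp: field_simps\<close>)
    have "(\<lambda>n. x - 1 / real n) \<longlonglongrightarrow> x - 0" by (intro tendsto_intros lim_1_over_n)
    then show "(\<lambda>n. x - 1 / real n) \<longlonglongrightarrow> x" by simp
  qed simp
  have b_lim: "(\<lambda>n. real (n - a n) / real n) \<longlonglongrightarrow> 1 - x"
  proof (rule Lim_transform_eventually)
    show "(\<lambda>n. 1 - real (a n) / real n) \<longlonglongrightarrow> 1 - x" by (intro tendsto_intros a_lim)
    show "\<forall>\<^sub>F n in sequentially. 1 - real (a n) / real n = real (n - a n) / real n"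
      using eventually_gt_at_top[of "0::nat"]
    proof eventually_elim
      case (elim n)
      then show ?case using a_lt[of n] by (simp add: of_nat_diff field_simps)
    qed
  qed
  have "(\<lambda>n. real (a n) / real n * (real (n - a n choose (k - 1)) / real n ^ (k - 1))
      + g * (real (a n) / real n) ^ k) \<longlonglongrightarrow> x * ((1 - x) ^ (k - 1) / fact (k - 1)) + g * x ^ k"
    by (intro tendsto_intros a_lim binomial_div_power_tendsto b_lim)
  moreover have "g < x * ((1 - x) ^ (k - 1) / fact (k - 1)) + g * x ^ k"
  proof -
    have "x ^ k < 1" using assms by (intro power_Suc_less_one[of x "k - 1", folded k])
    then have "g * (1 - x ^ k) < x * (1 - x) ^ (k - 1) / fact (k - 1)"
      using g by (simp add: pos_less_divide_eq mult_ac)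
    then show ?thesis by (simp add: algebra_simps)
  qed
  ultimately have "\<forall>\<^sub>F n in sequentially. g < real (a n) / real n *
      (real (n - a n choose (k - 1)) / real n ^ (k - 1)) + g * (real (a n) / real n) ^ k"
    by (rule order_tendstoD(1))
  then obtain n0 where n0: "\<And>n. n \<ge> n0 \<Longrightarrow> g < real (a n) / real n *
      (real (n - a n choose (k - 1)) / real n ^ (k - 1)) + g * (real (a n) / real n) ^ k"
    unfolding eventually_sequentially by blast
  \<comment> \<open>At least \<open>2\<close>, because the construction does not recurse for \<open>n \<le> 1\<close>.\<close>
  define m where "m = max 2 n0"
  define C where "C = \<bar>g\<bar> * real m ^ k"
  have "g * real n ^ k - C \<le> real (N n)" for n
  proof (induction n rule: less_induct)
    case (less n)
    show ?case
    proof (cases "n < m")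
      case True
      have "g * real n ^ k \<le> \<bar>g\<bar> * real n ^ k" by (rule mult_right_mono) auto
      also have "\<dots> \<le> C"
        unfolding C_def using True by (intro mult_left_mono power_mono) auto
      finally show ?thesis by simp
    next
      case False
      then have n: "n > 1" "n \<ge> n0" by (auto simp: m_def)
      have "g * real n ^ k \<le> (real (a n) / real n * (real (n - a n choose (k - 1)) / real n ^ (k - 1))
          + g * (real (a n) / real n) ^ k) * real n ^ k"
        using n0[OF n(2)] by (intro mult_right_mono) auto
      also have "\<dots> = real (a n) * real (n - a n choose (k - 1)) + g * real (a n) ^ k"
      proof -
        have "real n ^ k = real n * real n ^ (k - 1)" by (subst k) simp
        then show ?thesis using n by (simp add: distrib_right power_divide)
      qed
      finally have "g * real n ^ k - C
          \<le> real (a n) * real (n - a n choose (k - 1)) + (g * real (a n) ^ k - C)" by simp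
      also have "\<dots> \<le> real (a n) * real (n - a n choose (k - 1)) + real (N (a n))"
        using less.IH[OF a_lt[of n]] n by simp
      also have "\<dots> = real (a n * (n - a n choose (k - 1)) + N (a n))" by simp
      also have "\<dots> \<le> real (N n)"
        unfolding of_nat_le_iff N_def a_def
        by (rule card_induced_copies_iterated_digraph[OF assms(1-3) n(1)])
      finally show ?thesis .
    qed
  qed
  then show ?thesis unfolding N_def by (rule that)
qed

section \<open>The maximum of the bound\<close>

text \<open>
  Cancelling the factor \<open>1 - x\<close> shows continuity on the whole of \<open>[0, 1]\<close>.\<close>

lemma star_bound_eq_geometric:
  assumes "k \<ge> 3"
  shows "star_bound k x = real k * x * (1 - x) ^ (k - 2) / (\<Sum>i<k. x ^ i)"
proof (cases "x = 1")
  case True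
  then show ?thesis using assms by (simp add: star_bound_def)
next
  case False
  have "k - 1 = Suc (k - 2)" using assms by simp
  then have "star_bound k x
      = ((1 - x) * (real k * x * (1 - x) ^ (k - 2))) / ((1 - x) * (\<Sum>i<k. x ^ i))"
    using False by (simp add: star_bound_def one_diff_power_eq mult_ac)
  then show ?thesis using False by simp
qed

lemma star_bound_arg_max_exists:
  assumes "k \<ge> 3"
  obtains x where "is_arg_max (star_bound k) (\<lambda>x. x \<in> {0..1}) x"
proof -
  have pos: "(\<Sum>i<k. x ^ i) > 0" if "x \<in> {0..1}" for x :: real
  proof -
    have "0 < x ^ 0" by simp
    also have "x ^ 0 \<le> (\<Sum>i<k. x ^ i)"
      by (rule member_le_sum) (use that assms in auto)
    finally show ?thesis .
  qed
  have "continuous_on {0..1} (star_bound k)"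
    unfolding star_bound_eq_geometric[OF assms]
    by (intro continuous_intros) (use pos in force)
  then obtain x where "x \<in> {0..1}" "\<And>y. y \<in> {0..1} \<Longrightarrow> star_bound k y \<le> star_bound k x"
    using continuous_attains_sup[of "{0..1::real}" "star_bound k"] by auto
  then have "is_arg_max (star_bound k) (\<lambda>x. x \<in> {0..1}) x"
    by (auto simp: is_arg_max_def not_less)
  then show ?thesis by (rule that)
qed

lemma star_bound_arg_max_interior:
  assumes "k \<ge> 3" "is_arg_max (star_bound k) (\<lambda>x. x \<in> {0..1}) x"
  shows "0 < x" "x < 1"
proof -
  have "(1 / 2 :: real) ^ k < 1" using assms by (simp add: power_less_one_iff)
  then have "0 < star_bound k (1 / 2)" using assms by (simp add: star_bound_def)
  also have "star_bound k (1 / 2) \<le> star_bound k x"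
    using assms(2) by (fastforce simp: is_arg_max_def not_less)
  finally have "0 < star_bound k x" .
  then have "x \<noteq> 0" "x \<noteq> 1" by (auto simp: star_bound_def)
  then show "0 < x" "x < 1" using assms(2) by (auto simp: is_arg_max_def)
qed

section \<open>Densities\<close>

text \<open>
  That \<open>M\<close> bounds \<open>star_bound k\<close> says that \<open>c = M / k\<close> is admissible in the star weight bound. With all
  weights \<open>1\<close> this is at most \<open>M / k * n^k\<close>, and dividing by \<open>(k - 1)!\<close> bounds the number of copies.\<close>

lemma induced_density_directed_star_le:
  fixes G :: "'a pair_pre_digraph"
  assumes "k \<ge> 3" and G: "oriented_digraph G"
    and M: "\<And>x. x \<in> {0..1} \<Longrightarrow> star_bound k x \<le> M"
  shows "induced_density (directed_star k) G
    \<le> M / fact k * (real (card (pverts G)) ^ k / real (card (pverts G) choose k))"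
proof -
  interpret oriented_digraph G by (rule G)
  obtain m where m: "k = Suc m" "m > 0" using assms(1) by (cases k) auto
  define n where "n = card (pverts G)"
  have "x * (1 - x) ^ m \<le> M / real k * (1 - x ^ Suc m)" if "0 \<le> x" "x \<le> 1" for x
  proof (cases "x = 1")
    case True
    then show ?thesis using m by (simp add: power_0_left)
  next
    case False
    then have "x < 1" using that by simp
    then have "x ^ Suc m < 1" using that by (simp add: power_less_one_iff del: power_Suc)
    moreover have "real k * x * (1 - x) ^ m / (1 - x ^ Suc m) \<le> M"
      using M[of x] that False by (simp add: star_bound_def m)
    ultimately have "real k * (x * (1 - x) ^ m) \<le> M * (1 - x ^ Suc m)"
      by (simp add: divide_le_eq mult_ac)
    then show ?thesis using m by (simp add: field_simps)
  qed
  then have "star_weight (parcs G) (Suc m) (pverts G) (\<lambda>_. 1)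
      \<le> M / real k * sum (\<lambda>_. 1) (pverts G) ^ Suc m"
    using m(2) no_antiparallel pair_finite_verts by (intro star_weight_le) auto
  then have "fact m * real (card (induced_copies (directed_star k) G)) \<le> M / real k * real n ^ k"
    using induced_copies_directed_star_le_star_weight[OF G, of m] by (simp add: m(1) n_def)
  moreover have "fact k = real k * fact m" by (simp add: m(1))
  ultimately have "real (card (induced_copies (directed_star k) G)) \<le> M / fact k * real n ^ k"
    using assms(1) by (simp add: pos_le_divide_eq mult_ac)
  then have "real (card (induced_copies (directed_star k) G)) / real (n choose k)
      \<le> M / fact k * real n ^ k / real (n choose k)"
    by (rule divide_right_mono) simp
  then show ?thesis by (simp add: induced_density_def n_def directed_star_def)
qed

lemma power_div_binomial_tendsto: "(\<lambda>n. real n ^ k / real (n choose k)) \<longlonglongrightarrow> fact k"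
proof -
  have "(\<lambda>n. real n / real n) \<longlonglongrightarrow> 1"
    by (rule Lim_transform_eventually[OF tendsto_const])
      (use eventually_gt_at_top[of "0::nat"] in \<open>auto elim: eventually_mono\<close>)
  from tendsto_inverse[OF binomial_div_power_tendsto[OF this, of k]]
  show ?thesis by simp
qed

text \<open>
  The upper bound holds for every oriented graph; only the lower bound uses the construction.\<close>

lemma iterated_digraph_density_tendsto:
  assumes "k \<ge> 3" and x: "is_arg_max (star_bound k) (\<lambda>x. x \<in> {0..1}) x"
  shows "(\<lambda>n. induced_density (directed_star k) (iterated_digraph x n)) \<longlonglongrightarrow> star_bound k x"
proof (rule order_tendstoI)
  define M where "M = star_bound k x"
  have M: "star_bound k y \<le> M" if "y \<in> {0..1}" for y
    using x that by (auto simp: M_def is_arg_max_def not_less)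
  note x01 = star_bound_arg_max_interior[OF assms]
  {
    fix b assume "star_bound k x < b"
    have "(\<lambda>n. M / fact k * (real n ^ k / real (n choose k))) \<longlonglongrightarrow> M / fact k * fact k"
      by (intro tendsto_intros power_div_binomial_tendsto)
    then have "\<forall>\<^sub>F n in sequentially. M / fact k * (real n ^ k / real (n choose k)) < b"
      by (rule order_tendstoD(2)) (use \<open>star_bound k x < b\<close> in \<open>simp add: M_def\<close>)
    then show "\<forall>\<^sub>F n in sequentially. induced_density (directed_star k) (iterated_digraph x n) < b"
    proof eventually_elim
      case (elim n)
      then show ?case
        using induced_density_directed_star_le[OF assms(1) oriented_iterated_digraph M, of x n]
        by simp
    qed
  next
    fix b assume b: "b < star_bound k x"
    define g where "g = (b + M) / 2 / fact k"
    \<comment> \<open>The fixed point of the recursion is the density bound, up to the factor \<open>k!\<close>.\<close>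
    have kM: "x * (1 - x) ^ (k - 1) / fact (k - 1) / (1 - x ^ k) = M / fact k"
      using x01 assms(1) by (simp add: M_def star_bound_def fact_reduce[of k])
    have "g < M / fact k"
      unfolding g_def by (rule divide_strict_right_mono) (use b in \<open>simp_all add: M_def\<close>)
    then have "g < x * (1 - x) ^ (k - 1) / fact (k - 1) / (1 - x ^ k)" unfolding kM .
    then obtain C where C: "\<And>n. g * real n ^ k - C
        \<le> real (card (induced_copies (directed_star k) (iterated_digraph x n)))"
      using iterated_digraph_copies_lower[of k x g] x01 assms(1) by auto
    have "(\<lambda>n. (g - C * (1 / real n) ^ k) * (real n ^ k / real (n choose k)))
        \<longlonglongrightarrow> (g - C * 0 ^ k) * fact k"
      by (intro tendsto_intros power_div_binomial_tendsto lim_1_over_n)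
    moreover have "b < (g - C * 0 ^ k) * fact k"
    proof -
      have "g * fact k = (b + M) / 2" by (simp add: g_def)
      then show ?thesis using assms(1) b by (simp add: M_def power_0_left)
    qed
    ultimately have "\<forall>\<^sub>F n in sequentially.
        b < (g - C * (1 / real n) ^ k) * (real n ^ k / real (n choose k))"
      by (rule order_tendstoD(1))
    then show "\<forall>\<^sub>F n in sequentially. b < induced_density (directed_star k) (iterated_digraph x n)"
      using eventually_gt_at_top[of "0::nat"]
    proof eventually_elim
      case (elim n)
      have "(g - C * (1 / real n) ^ k) * (real n ^ k / real (n choose k))
          = (g * real n ^ k - C) / real (n choose k)"
      proof -
        have "(g - C * (1 / real n) ^ k) * real n ^ k = g * real n ^ k - C"
          using elim(2) by (simp add: power_divide left_diff_distrib)
        then show ?thesis by (simp only: times_divide_eq_right)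
      qed
      also have "\<dots> \<le> induced_density (directed_star k) (iterated_digraph x n)"
        using divide_right_mono[OF C[of n], of "real (n choose k)"]
        by (simp add: induced_density_def directed_star_def)
      finally show ?case using elim(1) by simp
    qed
  }
qed

text \<open>
  The maximal density lies between the density of the iterated construction and the general upper
  bound, and both converge to \<open>star_bound k x\<close>.\<close>

lemma inducibility_directed_star:
  assumes "k \<ge> 3" and x: "is_arg_max (star_bound k) (\<lambda>x. x \<in> {0..1}) x"
  shows "inducibility (directed_star k) = star_bound k x"
proof -
  define M where "M = star_bound k x"
  have M: "star_bound k y \<le> M" if "y \<in> {0..1}" for y
    using x that by (auto simp: M_def is_arg_max_def not_less)
  have "max_induced_density (directed_star k) \<longlonglongrightarrow> M"
  proof (rule real_tendsto_sandwich)
    show "(\<lambda>n. induced_density (directed_star k) (iterated_digraph x n)) \<longlonglongrightarrow> M"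
      unfolding M_def by (rule iterated_digraph_density_tendsto[OF assms])
    show "\<forall>\<^sub>F n in sequentially. induced_density (directed_star k) (iterated_digraph x n)
        \<le> max_induced_density (directed_star k) n"
      using induced_density_le_max[OF oriented_iterated_digraph, of "directed_star k" x] by simp
    have "max_induced_density (directed_star k) n \<le> M / fact k * (real n ^ k / real (n choose k))" for n
    proof -
      obtain G :: "nat pair_pre_digraph" where G: "oriented_digraph G" "card (pverts G) = n"
        "max_induced_density (directed_star k) n = induced_density (directed_star k) G"
        by (rule max_induced_density_attained)
      then show ?thesis using induced_density_directed_star_le[OF assms(1) G(1) M] by simp
    qed
    then show "\<forall>\<^sub>F n in sequentially. max_induced_density (directed_star k) n
        \<le> M / fact k * (real n ^ k / real (n choose k))" by simp
    have "(\<lambda>n. M / fact k * (real n ^ k / real (n choose k))) \<longlonglongrightarrow> M / fact k * fact k"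
      by (intro tendsto_intros power_div_binomial_tendsto)
    then show "(\<lambda>n. M / fact k * (real n ^ k / real (n choose k))) \<longlonglongrightarrow> M" by simp
  qed
  then show ?thesis
    unfolding M_def by (rule LIMSEQ_unique[OF inducibility_LIMSEQ])
qed

theorem mainTheorem1:
  fixes k :: nat
  assumes "k \<ge> 3"
  shows "(\<exists>x. is_arg_max (star_bound k) (\<lambda>x. x \<in> {0..1}) x \<and>
              inducibility (directed_star k) = star_bound k x) \<and>
         (\<forall>x. is_arg_max (star_bound k) (\<lambda>x. x \<in> {0..1}) x \<longrightarrow>
              (\<lambda>n. induced_density (directed_star k) (iterated_digraph x n))
                \<longlonglongrightarrow> inducibility (directed_star k))"
proof (intro conjI allI impI)
  obtain x where "is_arg_max (star_bound k) (\<lambda>x. x \<in> {0..1}) x"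
    by (rule star_bound_arg_max_exists[OF assms])
  then show "\<exists>x. is_arg_max (star_bound k) (\<lambda>x. x \<in> {0..1}) x \<and>
      inducibility (directed_star k) = star_bound k x"
    using inducibility_directed_star[OF assms] by blast
next
  fix x assume "is_arg_max (star_bound k) (\<lambda>x. x \<in> {0..1}) x"
  then show "(\<lambda>n. induced_density (directed_star k) (iterated_digraph x n))
      \<longlonglongrightarrow> inducibility (directed_star k)"
    using iterated_digraph_density_tendsto[OF assms] inducibility_directed_star[OF assms] by simp
qed

end
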